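(* Let $m\ge 1$ and let $\mathbf r=\{r_1,\dots,r_m\}$ be formal variables, together with formal variables $x$ and $q$. Let $\mathcal J$ be a set of $m$-tuples $\mathbf j=(j_1,\dots,j_m)$ of integers each $\ge -1$. Let $e(\mathbf r)$ and, for each $\mathbf j\in\mathcal J$, $f_{\mathbf j}(\mathbf r)$ be formal power series in $x,q,\mathbf r$. Suppose $F(\mathbf r)$ is a formal power series in $x,q,\mathbf r$ satisfying the functional equation $$F(\mathbf r)=e(\mathbf r)+\sum_{\mathbf j\in\mathcal J} x\,f_{\mathbf j}(\mathbf r)\,F\big((q^{j_1}r_1)^{\varepsilon(j_1)},\dots,(q^{j_m}r_m)^{\varepsilon(j_m)}\big),$$ where $\varepsilon(j)=1$ if $j\ge 0$ and $\varepsilon(j)=0$ if $j=-1$ (so the $i$-th argument is $q^{j_i}r_i$ if $j_i\ge0$ and $1$ if $j_i=-1$). Then $$F(\mathbf r)=\sum_{n\ge 0}x^n\sum_{\substack{J=(\mathbf j_1,\dots,\mathbf j_n)\\ \mathbf j_k\in\mathcal J}} e\big(q^{a_{1,n+1}}r_1^{b_{1,n+1}},\dots,q^{a_{m,n+1}}r_m^{b_{m,n+1}}\big)\prod_{k=1}^n f_{\mathbf j_k}\big(q^{a_{1,k}}r_1^{b_{1,k}},\dots,q^{a_{m,k}}r_m^{b_{m,k}}\big),$$ where the inner sum is over all length-$n$ sequences $J$ of elements of $\mathcal J$, and the integers $a_{i,k},b_{i,k}$ ($1\le i\le m$, $1\le k\le n+1$) are defined from $J$ as follows.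
   Context: For a sequence $J=(\mathbf j_1,\dots,\mathbf j_n)$ with $\mathbf j_k=(j_{1,k},\dots,j_{m,k})$: set $a_{i,1}=0$ and $b_{i,1}=1$ for all $i$. For $2\le k\le n+1$, consider the sequence $(j_{i,1},j_{i,2},\dots,j_{i,k-1})$ of $i$-th entries of the first $k-1$ terms of $J$. If $-1$ occurs in this sequence, let $b_{i,k}=0$ and let $a_{i,k}$ be the sum of the entries of this sequence occurring after the last occurrence of $-1$; otherwise let $b_{i,k}=1$ and let $a_{i,k}$ be the sum of all entries of this sequence. Here $r_i^{0}=1$. All identities are identities of formal power series (the sum over $n$ converges formally in $x$).
   Formalization: The formal theorem assumes that the functional equation makes sense and that, for each n, every monomial gets only finitely many contributions when the terms of e and the f_j are expanded jointly over all J; for infinite 𝒥 the identity can fail without this. *)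

theory Defs
  imports "HOL-Analysis.Infinite_Sum" "HOL-Library.Function_Algebras"
begin

section \<open>Formal power series in finitely many variables\<close>

text \<open>
  A formal power series in the variables \<^typ>\<open>'v\<close> is its family of coefficients, indexed by the
  exponent vectors \<^typ>\<open>'v \<Rightarrow> nat\<close>; addition of exponent vectors is pointwise
  (\<^theory>\<open>HOL-Library.Function_Algebras\<close>).
\<close>

typedef ('v, 'a) mfps = "UNIV :: (('v \<Rightarrow> nat) \<Rightarrow> 'a) set"
  morphisms mfps_nth Abs_mfps ..

lemma mfps_nth_Abs [simp]: "mfps_nth (Abs_mfps c) = c"
  by (simp add: Abs_mfps_inverse)

lemma mfps_eqI: "(\<And>\<mu>. mfps_nth f \<mu> = mfps_nth g \<mu>) \<Longrightarrow> f = g"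
  by (metis ext mfps_nth_inject)

lemma mfps_eq_iff: "f = g \<longleftrightarrow> (\<forall>\<mu>. mfps_nth f \<mu> = mfps_nth g \<mu>)"
  by (auto intro: mfps_eqI)

lemma finite_exponents_le: "finite {\<alpha>. \<alpha> \<le> (\<mu> :: 'v::finite \<Rightarrow> nat)}"
proof (rule finite_subset)
  show "{\<alpha>. \<alpha> \<le> \<mu>} \<subseteq> PiE UNIV (\<lambda>v. {..\<mu> v})"
    by (auto simp: le_fun_def)
qed (simp add: finite_PiE)

lemma finite_exponent_splits: "finite {(\<alpha>, \<beta>). \<alpha> + \<beta> = (\<mu> :: 'v::finite \<Rightarrow> nat)}"
proof (rule finite_subset)
  show "{(\<alpha>, \<beta>). \<alpha> + \<beta> = \<mu>} \<subseteq> {\<alpha>. \<alpha> \<le> \<mu>} \<times> {\<beta>. \<beta> \<le> \<mu>}"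
    by (auto simp: le_fun_def)
qed (simp add: finite_exponents_le)

instantiation mfps :: (type, ab_group_add) ab_group_add
begin

definition "0 = Abs_mfps (\<lambda>_. 0)"
definition "f + g = Abs_mfps (\<lambda>\<mu>. mfps_nth f \<mu> + mfps_nth g \<mu>)"
definition "- f = Abs_mfps (\<lambda>\<mu>. - mfps_nth f \<mu>)"
definition "f - g = Abs_mfps (\<lambda>\<mu>. mfps_nth f \<mu> - mfps_nth g \<mu>)"

instance
  by standard
    (simp_all add: mfps_eq_iff zero_mfps_def plus_mfps_def uminus_mfps_def minus_mfps_def
      algebra_simps)

end

lemma mfps_nth_0 [simp]: "mfps_nth 0 \<mu> = 0"
  and mfps_nth_add [simp]: "mfps_nth (f + g) \<mu> = mfps_nth f \<mu> + mfps_nth g \<mu>"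
  and mfps_nth_uminus [simp]: "mfps_nth (- f) \<mu> = - mfps_nth f \<mu>"
  and mfps_nth_diff [simp]: "mfps_nth (f - g) \<mu> = mfps_nth f \<mu> - mfps_nth g \<mu>"
  by (simp_all add: zero_mfps_def plus_mfps_def uminus_mfps_def minus_mfps_def)

definition monom :: "('v \<Rightarrow> nat) \<Rightarrow> 'a::zero \<Rightarrow> ('v, 'a) mfps" where
  "monom \<mu> c = Abs_mfps (\<lambda>\<nu>. if \<nu> = \<mu> then c else 0)"

lemma mfps_nth_monom [simp]: "mfps_nth (monom \<mu> c) \<nu> = (if \<nu> = \<mu> then c else 0)"
  by (simp add: monom_def)

instantiation mfps :: (finite, comm_ring_1) comm_ring_1
begin

definition "1 = monom 0 1"
definition "f * g = Abs_mfps (\<lambda>\<mu>. \<Sum>(\<alpha>, \<beta>) | \<alpha> + \<beta> = \<mu>. mfps_nth f \<alpha> * mfps_nth g \<beta>)"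

lemma mfps_nth_mult_aux:
  "mfps_nth (f * g) \<mu> = (\<Sum>(\<alpha>, \<beta>) | \<alpha> + \<beta> = \<mu>. mfps_nth f \<alpha> * mfps_nth g \<beta>)"
  by (simp add: times_mfps_def)

instance
proof
  fix f g h :: "('a, 'b) mfps"
  show "f * g * h = f * (g * h)"
  proof (rule mfps_eqI)
    fix \<mu> :: "'a \<Rightarrow> nat"
    let ?t = "\<lambda>(\<alpha>, \<beta>, \<gamma>). mfps_nth f \<alpha> * mfps_nth g \<beta> * mfps_nth h \<gamma>"
    have "mfps_nth (f * g * h) \<mu> =
        (\<Sum>p | fst p + snd p = \<mu>. \<Sum>p' | fst p' + snd p' = fst p.
          mfps_nth f (fst p') * mfps_nth g (snd p') * mfps_nth h (snd p))"
      by (simp add: mfps_nth_mult_aux sum_distrib_right case_prod_unfold)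
    also have "\<dots> = (\<Sum>(p, p') \<in> (SIGMA p:{p. fst p + snd p = \<mu>}. {p'. fst p' + snd p' = fst p}).
          mfps_nth f (fst p') * mfps_nth g (snd p') * mfps_nth h (snd p))"
      using finite_exponent_splits by (subst sum.Sigma) (auto simp: case_prod_unfold)
    also have "\<dots> = sum ?t {(\<alpha>, \<beta>, \<gamma>). \<alpha> + \<beta> + \<gamma> = \<mu>}"
      by (rule sum.reindex_bij_witness
          [where j = "\<lambda>(p, p'). (fst p', snd p', snd p)"
             and i = "\<lambda>(\<alpha>, \<beta>, \<gamma>). ((\<alpha> + \<beta>, \<gamma>), (\<alpha>, \<beta>))"]) auto
    finally have 1: "mfps_nth (f * g * h) \<mu> = sum ?t {(\<alpha>, \<beta>, \<gamma>). \<alpha> + \<beta> + \<gamma> = \<mu>}" .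
    have "mfps_nth (f * (g * h)) \<mu> =
        (\<Sum>p | fst p + snd p = \<mu>. \<Sum>p' | fst p' + snd p' = snd p.
          mfps_nth f (fst p) * (mfps_nth g (fst p') * mfps_nth h (snd p')))"
      by (simp add: mfps_nth_mult_aux sum_distrib_left case_prod_unfold)
    also have "\<dots> = (\<Sum>(p, p') \<in> (SIGMA p:{p. fst p + snd p = \<mu>}. {p'. fst p' + snd p' = snd p}).
          mfps_nth f (fst p) * (mfps_nth g (fst p') * mfps_nth h (snd p')))"
      using finite_exponent_splits by (subst sum.Sigma) (auto simp: case_prod_unfold)
    also have "\<dots> = sum ?t {(\<alpha>, \<beta>, \<gamma>). \<alpha> + \<beta> + \<gamma> = \<mu>}"
      by (rule sum.reindex_bij_witness
          [where j = "\<lambda>(p, p'). (fst p, fst p', snd p')"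
             and i = "\<lambda>(\<alpha>, \<beta>, \<gamma>). ((\<alpha>, \<beta> + \<gamma>), (\<beta>, \<gamma>))"])
        (auto simp: mult.assoc add.assoc)
    finally show "mfps_nth (f * g * h) \<mu> = mfps_nth (f * (g * h)) \<mu>"
      using 1 by simp
  qed
  show "f * g = g * f"
  proof (rule mfps_eqI)
    fix \<mu> :: "'a \<Rightarrow> nat"
    show "mfps_nth (f * g) \<mu> = mfps_nth (g * f) \<mu>"
      unfolding mfps_nth_mult_aux
      by (rule sum.reindex_bij_witness[where i = prod.swap and j = prod.swap])
        (auto simp: add.commute mult.commute)
  qed
  show "1 * f = f"
  proof (rule mfps_eqI)
    fix \<mu> :: "'a \<Rightarrow> nat"
    have "mfps_nth (1 * f) \<mu> =
        (\<Sum>p | fst p + snd p = \<mu>. if p = (0, \<mu>) then mfps_nth f \<mu> else 0)"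
      unfolding mfps_nth_mult_aux by (rule sum.cong) (auto simp: one_mfps_def split: if_splits)
    also have "\<dots> = mfps_nth f \<mu>"
      using finite_exponent_splits[of \<mu>] by (subst sum.delta) (simp_all add: case_prod_unfold)
    finally show "mfps_nth (1 * f) \<mu> = mfps_nth f \<mu>" .
  qed
  show "(f + g) * h = f * h + g * h"
    by (rule mfps_eqI)
      (simp add: mfps_nth_mult_aux case_prod_unfold sum.distrib[symmetric] distrib_right)
  show "(0 :: ('a, 'b) mfps) \<noteq> 1"
    by (simp add: mfps_eq_iff one_mfps_def)
qed

end

lemma mfps_nth_mult:
  "mfps_nth (f * g) \<mu> = (\<Sum>(\<alpha>, \<beta>) | \<alpha> + \<beta> = \<mu>. mfps_nth f \<alpha> * mfps_nth g \<beta>)"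
  by (rule mfps_nth_mult_aux)

lemma mfps_nth_1: "mfps_nth 1 \<mu> = (if \<mu> = 0 then 1 else 0)"
  by (simp add: one_mfps_def)

definition mvar :: "'v \<Rightarrow> ('v, 'a::zero_neq_one) mfps" where
  "mvar v = monom (\<lambda>w. if w = v then 1 else 0) 1"

text \<open>
  The topology of coefficientwise stabilisation (the product topology over discrete
  coefficients).  A family is \<^const>\<open>summable_on\<close> in it iff every exponent vector has a nonzero
  coefficient in only finitely many members, i.e. iff its sum exists as a formal power series.
\<close>

instantiation mfps :: (type, type) t2_space
begin

definition open_mfps :: "('a, 'b) mfps set \<Rightarrow> bool" where
  "open_mfps U \<longleftrightarrow>
    (\<forall>f\<in>U. \<exists>S. finite S \<and> (\<forall>g. (\<forall>\<mu>\<in>S. mfps_nth g \<mu> = mfps_nth f \<mu>) \<longrightarrow> g \<in> U))"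

instance
proof
  show "open (UNIV :: ('a, 'b) mfps set)"
    by (auto simp: open_mfps_def)
next
  fix S T :: "('a, 'b) mfps set"
  assume ST: "open S" "open T"
  show "open (S \<inter> T)"
    unfolding open_mfps_def
  proof
    fix f assume "f \<in> S \<inter> T"
    then have "f \<in> S" "f \<in> T" by simp_all
    obtain A where A: "finite A" "\<forall>g. (\<forall>\<mu>\<in>A. mfps_nth g \<mu> = mfps_nth f \<mu>) \<longrightarrow> g \<in> S"
      using bspec[OF ST(1)[unfolded open_mfps_def] \<open>f \<in> S\<close>] by (elim exE conjE)
    obtain B where B: "finite B" "\<forall>g. (\<forall>\<mu>\<in>B. mfps_nth g \<mu> = mfps_nth f \<mu>) \<longrightarrow> g \<in> T"
      using bspec[OF ST(2)[unfolded open_mfps_def] \<open>f \<in> T\<close>] by (elim exE conjE)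
    from A B show "\<exists>C. finite C \<and> (\<forall>g. (\<forall>\<mu>\<in>C. mfps_nth g \<mu> = mfps_nth f \<mu>) \<longrightarrow> g \<in> S \<inter> T)"
      by (intro exI[of _ "A \<union> B"]) simp
  qed
next
  fix K :: "('a, 'b) mfps set set"
  assume K: "\<forall>S\<in>K. open S"
  show "open (\<Union> K)"
    unfolding open_mfps_def
  proof
    fix f assume "f \<in> \<Union> K"
    then obtain S where S: "S \<in> K" "f \<in> S" by blast
    have "open S" using K S(1) by (rule bspec)
    obtain A where A: "finite A" "\<forall>g. (\<forall>\<mu>\<in>A. mfps_nth g \<mu> = mfps_nth f \<mu>) \<longrightarrow> g \<in> S"
      using bspec[OF \<open>open S\<close>[unfolded open_mfps_def] S(2)] by (elim exE conjE)
    show "\<exists>A. finite A \<and> (\<forall>g. (\<forall>\<mu>\<in>A. mfps_nth g \<mu> = mfps_nth f \<mu>) \<longrightarrow> g \<in> \<Union> K)"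
    proof (intro exI[of _ A] conjI allI impI)
      fix g assume "\<forall>\<mu>\<in>A. mfps_nth g \<mu> = mfps_nth f \<mu>"
      with A(2) have "g \<in> S" by simp
      with S(1) show "g \<in> \<Union> K" by (rule UnionI)
    qed (rule A(1))
  qed
next
  fix f g :: "('a, 'b) mfps"
  assume "f \<noteq> g"
  then obtain \<mu> where \<mu>: "mfps_nth f \<mu> \<noteq> mfps_nth g \<mu>" by (auto simp: mfps_eq_iff)
  have op: "open {h :: ('a, 'b) mfps. mfps_nth h \<mu> = c}" for c
    unfolding open_mfps_def by (intro ballI exI[of _ "{\<mu>}"]) auto
  show "\<exists>U V. open U \<and> open V \<and> f \<in> U \<and> g \<in> V \<and> U \<inter> V = {}"
  proof (rule exI, rule exI, intro conjI)
    show "open {h :: ('a, 'b) mfps. mfps_nth h \<mu> = mfps_nth f \<mu>}" by (rule op)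
    show "open {h :: ('a, 'b) mfps. mfps_nth h \<mu> = mfps_nth g \<mu>}" by (rule op)
  qed (use \<mu> in auto)
qed

end


section \<open>Series in x, q, r and the substitutions r i := q ^ a i * r i ^ b i\<close>

text \<open>The index type \<^typ>\<open>'m\<close> plays the role of \<open>{1..m}\<close>.\<close>

datatype 'm indet = X_var | Q_var | R_var 'm

instance indet :: (finite) finite
proof
  have "(UNIV :: 'a indet set) = insert X_var (insert Q_var (range R_var))"
    by (auto intro: indet.exhaust)
  then show "finite (UNIV :: 'a indet set)"
    by (rule ssubst) simp
qed

text \<open>The exponent vector of the image of the monomial with exponent vector \<open>\<nu>\<close>.\<close>

definition subst_exponent ::
    "('m::finite \<Rightarrow> nat) \<Rightarrow> ('m \<Rightarrow> nat) \<Rightarrow> ('m indet \<Rightarrow> nat) \<Rightarrow> ('m indet \<Rightarrow> nat)" where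
  "subst_exponent a b \<nu> = (\<lambda>v. case v of
      X_var \<Rightarrow> \<nu> X_var
    | Q_var \<Rightarrow> \<nu> Q_var + (\<Sum>i\<in>UNIV. a i * \<nu> (R_var i))
    | R_var i \<Rightarrow> b i * \<nu> (R_var i))"

text \<open>
  Substituting \<open>r i := 1\<close> (that is, \<open>a i = b i = 0\<close>) in a formal power series need not be
  meaningful; \<open>substitutable\<close> says that the substitution converges.
\<close>

definition substitutable ::
    "('m::finite \<Rightarrow> nat) \<Rightarrow> ('m \<Rightarrow> nat) \<Rightarrow> ('m indet, 'a::comm_ring_1) mfps \<Rightarrow> bool" where
  "substitutable a b G \<longleftrightarrow> (\<lambda>\<nu>. monom (subst_exponent a b \<nu>) (mfps_nth G \<nu>)) summable_on UNIV"

definition subst_r ::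
    "('m::finite \<Rightarrow> nat) \<Rightarrow> ('m \<Rightarrow> nat) \<Rightarrow> ('m indet, 'a::comm_ring_1) mfps \<Rightarrow> ('m indet, 'a) mfps"
  where
  "subst_r a b G = (\<Sum>\<^sub>\<infinity>\<nu>. monom (subst_exponent a b \<nu>) (mfps_nth G \<nu>))"

definition eps :: "int \<Rightarrow> nat" where
  "eps t = (if t \<ge> 0 then 1 else 0)"

text \<open>
  The argument \<open>(q ^ j i * r i) ^ eps (j i)\<close> of the functional equation is
  \<open>q ^ step_q j i * r i ^ step_r j i\<close>.
\<close>

definition step_q :: "('m \<Rightarrow> int) \<Rightarrow> 'm \<Rightarrow> nat" where
  "step_q j i = nat (j i) * eps (j i)"

definition step_r :: "('m \<Rightarrow> int) \<Rightarrow> 'm \<Rightarrow> nat" where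
  "step_r j i = eps (j i)"


section \<open>The exponents a, b attached to a sequence of tuples\<close>

text \<open>
  Positions \<open>k\<close> are counted from 1, so the \<open>k\<close>-th tuple of \<open>J\<close> is \<open>J ! (k - 1)\<close>.  For \<open>k = 1\<close> the
  sequence of entries is empty, which gives the initial values \<open>a = 0\<close> and \<open>b = 1\<close>.  If all
  entries are at least -1, the sum in \<open>a_exp\<close> is nonnegative and \<^const>\<open>nat\<close> does not
  truncate it.
\<close>

definition entries :: "('m \<Rightarrow> int) list \<Rightarrow> 'm \<Rightarrow> nat \<Rightarrow> int list" where
  "entries J i k = map (\<lambda>j. j i) (take (k - 1) J)"

definition after_last :: "'b \<Rightarrow> 'b list \<Rightarrow> 'b list" where
  "after_last t xs = rev (takeWhile (\<lambda>y. y \<noteq> t) (rev xs))"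

definition b_exp :: "('m \<Rightarrow> int) list \<Rightarrow> nat \<Rightarrow> 'm \<Rightarrow> nat" where
  "b_exp J k i = (if -1 \<in> set (entries J i k) then 0 else 1)"

definition a_exp :: "('m \<Rightarrow> int) list \<Rightarrow> nat \<Rightarrow> 'm \<Rightarrow> nat" where
  "a_exp J k i = nat (if -1 \<in> set (entries J i k)
      then sum_list (after_last (-1) (entries J i k))
      else sum_list (entries J i k))"

definition sequences :: "'j set \<Rightarrow> nat \<Rightarrow> 'j list set" where
  "sequences \<J> n = {J. length J = n \<and> set J \<subseteq> \<J>}"

definition seq_term ::
    "('m indet, 'a) mfps \<Rightarrow> (('m::finite \<Rightarrow> int) \<Rightarrow> ('m indet, 'a::comm_ring_1) mfps) \<Rightarrow>
      ('m \<Rightarrow> int) list \<Rightarrow> ('m indet, 'a) mfps" where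
  "seq_term e f J =
    subst_r (a_exp J (length J + 1)) (b_exp J (length J + 1)) e *
    (\<Prod>k=1..length J. subst_r (a_exp J k) (b_exp J k) (f (J ! (k - 1))))"

text \<open>
  Convergence of the sum of \<^const>\<open>seq_term\<close> over all sequences of a given length.  Picking a
  monomial \<open>\<nu> k\<close> of \<open>f (J ! (k - 1))\<close> for each \<open>k\<close> and a monomial \<open>\<nu> (n + 1)\<close> of \<open>e\<close> gives one
  contribution, to the coefficient at the sum of the substituted exponent vectors; every
  coefficient is required to receive only finitely many contributions.  The exponent vectors
  \<open>\<nu> 1, ..., \<nu> (n + 1)\<close> form the list \<open>\<nu>s\<close>.

  This is automatic if the set of tuples is finite and either all tuples have nonnegative
  entries, or the coefficients of each power product of x and q in \<open>e\<close> and the \<open>f j\<close> are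
  polynomials in the \<open>r i\<close>.  Without any such condition the substitutions \<open>r i := 1\<close> and the
  sums over infinitely many tuples have no meaning.
\<close>

definition contributions ::
    "('m::finite \<Rightarrow> int) set \<Rightarrow> ('m indet, 'a::comm_ring_1) mfps \<Rightarrow>
      (('m \<Rightarrow> int) \<Rightarrow> ('m indet, 'a) mfps) \<Rightarrow> nat \<Rightarrow> ('m indet \<Rightarrow> nat) \<Rightarrow>
      (('m \<Rightarrow> int) list \<times> ('m indet \<Rightarrow> nat) list) set" where
  "contributions \<J> e f n \<mu> = {(J, \<nu>s).
      J \<in> sequences \<J> n \<and> length \<nu>s = n + 1 \<and>
      (\<forall>k\<in>{1..n}. mfps_nth (f (J ! (k - 1))) (\<nu>s ! (k - 1)) \<noteq> 0) \<and>
      mfps_nth e (\<nu>s ! n) \<noteq> 0 \<and>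
      (\<Sum>k=1..n + 1. subst_exponent (a_exp J k) (b_exp J k) (\<nu>s ! (k - 1))) = \<mu>}"

definition expansion_converges ::
    "('m::finite \<Rightarrow> int) set \<Rightarrow> ('m indet, 'a::comm_ring_1) mfps \<Rightarrow>
      (('m \<Rightarrow> int) \<Rightarrow> ('m indet, 'a) mfps) \<Rightarrow> bool" where
  "expansion_converges \<J> e f \<longleftrightarrow> (\<forall>n \<mu>. finite (contributions \<J> e f n \<mu>))"

end

theory Submission
  imports Defs
begin

text \<open>
  Let \<open>S j\<close> be the substitution belonging to the tuple \<open>j\<close> and \<open>T n\<close> the sum of \<^const>\<open>seq_term\<close> over
  all sequences of length \<open>n\<close>.  Splitting off the first tuple of a sequence composes all later
  substitutions with \<open>S j\<close>, so \<open>T 0 = e\<close> and \<open>T (n + 1)\<close> is the sum of \<open>f j * S j (T n)\<close> over all \<open>j\<close>.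
  The remainders \<open>R N = F - (\<Sum>n<N. x ^ n * T n)\<close> therefore satisfy \<open>R (N + 1) = (\<Sum>j. x * f j * S j (R N))\<close>,
  and as \<open>S j\<close> preserves the degree in \<open>x\<close>, every monomial of \<open>R N\<close> has degree at least \<open>N\<close> in \<open>x\<close>.
\<close>

section \<open>The topology of coefficientwise stabilisation\<close>

lemma open_mfps_coeff: "open {g. mfps_nth g \<mu> = c}"
  unfolding open_mfps_def by (intro ballI exI[of _ "{\<mu>}"]) auto

text \<open>Every neighbourhood contains a basic one that fixes finitely many coefficients, and
  finitely many eventual conditions hold eventually together. Limits can thus be checked one
  coefficient at a time.\<close>

lemma tendsto_mfps_iff:
  "(f \<longlongrightarrow> l) F \<longleftrightarrow> (\<forall>\<mu>. eventually (\<lambda>x. mfps_nth (f x) \<mu> = mfps_nth l \<mu>) F)"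
proof
  assume "(f \<longlongrightarrow> l) F"
  from topological_tendstoD[OF this open_mfps_coeff]
  show "\<forall>\<mu>. eventually (\<lambda>x. mfps_nth (f x) \<mu> = mfps_nth l \<mu>) F"
    by simp
next
  assume ev: "\<forall>\<mu>. eventually (\<lambda>x. mfps_nth (f x) \<mu> = mfps_nth l \<mu>) F"
  show "(f \<longlongrightarrow> l) F"
  proof (rule topological_tendstoI)
    fix U assume "open U" "l \<in> U"
    from bspec[OF this(1)[unfolded open_mfps_def] this(2)] obtain S where
      S: "finite S" "\<And>g. (\<forall>\<mu>\<in>S. mfps_nth g \<mu> = mfps_nth l \<mu>) \<Longrightarrow> g \<in> U"
      by blast
    have "eventually (\<lambda>x. \<forall>\<mu>\<in>S. mfps_nth (f x) \<mu> = mfps_nth l \<mu>) F"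
      using S(1) ev by (intro eventually_ball_finite) auto
    then show "eventually (\<lambda>x. f x \<in> U) F"
      by (rule eventually_mono) (rule S(2))
  qed
qed

lemma eventually_mfps_nth_nhds:
  "eventually (\<lambda>g. mfps_nth g \<mu> = mfps_nth a \<mu>) (nhds a)"
  using filterlim_ident[of "nhds a"] by (simp add: tendsto_mfps_iff)

text \<open>The basic neighbourhoods are open and closed, since membership depends only on the
  coefficients in a finite set. Regularity is what \<open>has_sum_SigmaD\<close> needs to evaluate a
  sum over pairs as an iterated sum.\<close>

instance mfps :: (type, type) t3_space
proof
  fix S :: "('a, 'b) mfps set" and y
  assume "closed S" "y \<notin> S"
  then have "open (- S)" "y \<in> - S" by (simp_all add: open_Compl)
  from bspec[OF this(1)[unfolded open_mfps_def] this(2)] obtain A where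
    A: "finite A" "\<And>g. (\<forall>\<mu>\<in>A. mfps_nth g \<mu> = mfps_nth y \<mu>) \<Longrightarrow> g \<in> - S"
    by blast
  let ?U = "{g. \<forall>\<mu>\<in>A. mfps_nth g \<mu> = mfps_nth y \<mu>}"
  have "open ?U" "open (- ?U)"
    unfolding open_mfps_def using A(1) by (auto intro!: exI[of _ A])
  with A(2) show "\<exists>U V. open U \<and> open V \<and> y \<in> U \<and> S \<subseteq> V \<and> U \<inter> V = {}"
    by (intro exI[of _ ?U] exI[of _ "- ?U"]) auto
qed

instance mfps :: (type, ab_group_add) topological_ab_group_add
proof
  fix a b :: "('a, 'b) mfps"
  have fst: "(fst \<longlongrightarrow> a) (nhds a \<times>\<^sub>F nhds b)" and snd: "(snd \<longlongrightarrow> b) (nhds a \<times>\<^sub>F nhds b)"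
    by (rule filterlim_fst filterlim_snd)+
  show "((\<lambda>x. fst x + snd x) \<longlongrightarrow> a + b) (nhds a \<times>\<^sub>F nhds b)"
    unfolding tendsto_mfps_iff
  proof
    fix \<mu>
    show "eventually (\<lambda>x. mfps_nth (fst x + snd x) \<mu> = mfps_nth (a + b) \<mu>) (nhds a \<times>\<^sub>F nhds b)"
      using fst[unfolded tendsto_mfps_iff, THEN spec, of \<mu>]
        snd[unfolded tendsto_mfps_iff, THEN spec, of \<mu>]
      by eventually_elim simp
  qed
  show "(uminus \<longlongrightarrow> - a) (nhds a)"
    unfolding tendsto_mfps_iff
  proof
    fix \<mu>
    show "eventually (\<lambda>x. mfps_nth (- x) \<mu> = mfps_nth (- a) \<mu>) (nhds a)"
      using eventually_mfps_nth_nhds[of \<mu> a] by eventually_elim simp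
  qed
qed

text \<open>The coefficient of a product at \<mu> involves only the finitely many coefficients of
  the factors at exponents \<alpha> \<le> \<mu>.\<close>

instance mfps :: (finite, comm_ring_1) topological_semigroup_mult
proof
  fix a b :: "('a, 'b) mfps"
  let ?F = "nhds a \<times>\<^sub>F nhds b"
  have fst: "(fst \<longlongrightarrow> a) ?F" and snd: "(snd \<longlongrightarrow> b) ?F"
    by (rule filterlim_fst filterlim_snd)+
  show "((\<lambda>x. fst x * snd x) \<longlongrightarrow> a * b) ?F"
    unfolding tendsto_mfps_iff
  proof
    fix \<mu> :: "'a \<Rightarrow> nat"
    let ?S = "{\<alpha>. \<alpha> \<le> \<mu>}"
    have "eventually (\<lambda>x. \<forall>\<alpha>\<in>?S. mfps_nth (fst x) \<alpha> = mfps_nth a \<alpha>) ?F"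
      using fst by (intro eventually_ball_finite finite_exponents_le) (simp add: tendsto_mfps_iff)
    moreover have "eventually (\<lambda>x. \<forall>\<alpha>\<in>?S. mfps_nth (snd x) \<alpha> = mfps_nth b \<alpha>) ?F"
      using snd by (intro eventually_ball_finite finite_exponents_le) (simp add: tendsto_mfps_iff)
    ultimately show "eventually (\<lambda>x. mfps_nth (fst x * snd x) \<mu> = mfps_nth (a * b) \<mu>) ?F"
    proof eventually_elim
      case (elim x)
      show ?case
        unfolding mfps_nth_mult
      proof (intro sum.cong refl, clarify)
        fix \<alpha> \<beta> assume "\<mu> = \<alpha> + \<beta>"
        then have "\<alpha> \<in> ?S" "\<beta> \<in> ?S" by (auto simp: le_fun_def)
        with elim show "mfps_nth (fst x) \<alpha> * mfps_nth (snd x) \<beta> = mfps_nth a \<alpha> * mfps_nth b \<beta>"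
          by simp
      qed
    qed
  qed
qed

section \<open>Coefficients of infinite sums\<close>

lemma mfps_nth_sum: "mfps_nth (sum g A) \<mu> = (\<Sum>i\<in>A. mfps_nth (g i) \<mu>)"
  by (induction A rule: infinite_finite_induct) simp_all

text \<open>Finite partial sums that include all indices with a nonzero coefficient at \<mu> agree
  at \<mu>, so these finite coefficient sums assemble to the limit.\<close>

lemma summable_on_mfps:
  assumes "\<And>\<mu>. finite {i\<in>A. mfps_nth (g i) \<mu> \<noteq> 0}"
  shows "g summable_on A"
proof -
  let ?s = "Abs_mfps (\<lambda>\<mu>. \<Sum>i | i \<in> A \<and> mfps_nth (g i) \<mu> \<noteq> 0. mfps_nth (g i) \<mu>)"
  have "(g has_sum ?s) A"
    unfolding has_sum_def tendsto_mfps_iff eventually_finite_subsets_at_top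
  proof (intro allI exI conjI impI; (elim conjE)?)
    fix \<mu> Y
    show "finite {i\<in>A. mfps_nth (g i) \<mu> \<noteq> 0}" by (rule assms)
    assume "finite Y" "{i\<in>A. mfps_nth (g i) \<mu> \<noteq> 0} \<subseteq> Y" "Y \<subseteq> A"
    then show "mfps_nth (sum g Y) \<mu> = mfps_nth ?s \<mu>"
      unfolding mfps_nth_sum mfps_nth_Abs by (intro sum.mono_neutral_right) auto
  qed auto
  then show ?thesis by (rule has_sum_imp_summable)
qed

text \<open>At \<mu> the partial sums are constant from some finite \<open>X\<close> on. Enlarging
  \<open>X\<close> by \<open>S\<close> keeps this value, and the indices outside \<open>S\<close>
  contribute zero.\<close>

lemma mfps_nth_has_sum:
  assumes s: "(g has_sum s) A"
    and fin: "finite S" "S \<subseteq> A" and zero: "\<And>i. i \<in> A - S \<Longrightarrow> mfps_nth (g i) \<mu> = 0"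
  shows "mfps_nth s \<mu> = (\<Sum>i\<in>S. mfps_nth (g i) \<mu>)"
proof -
  obtain X where X: "finite X" "X \<subseteq> A"
    "\<And>Y. finite Y \<Longrightarrow> X \<subseteq> Y \<Longrightarrow> Y \<subseteq> A \<Longrightarrow> mfps_nth (sum g Y) \<mu> = mfps_nth s \<mu>"
    using s unfolding has_sum_def tendsto_mfps_iff eventually_finite_subsets_at_top by metis
  have "mfps_nth s \<mu> = (\<Sum>i\<in>X \<union> S. mfps_nth (g i) \<mu>)"
    using X(3)[of "X \<union> S"] X(1,2) fin by (simp add: mfps_nth_sum)
  also have "\<dots> = (\<Sum>i\<in>S. mfps_nth (g i) \<mu>)"
    using X(1,2) fin zero by (intro sum.mono_neutral_right) auto
  finally show ?thesis .
qed

lemma mfps_nth_has_sum_eq_0: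
  assumes "(g has_sum s) A" "\<And>i. i \<in> A \<Longrightarrow> mfps_nth (g i) \<mu> = 0"
  shows "mfps_nth s \<mu> = 0"
  using mfps_nth_has_sum[OF assms(1), of "{}" \<mu>] assms(2) by simp


section \<open>Monomials\<close>

lemma monom_0 [simp]: "monom \<mu> 0 = (0 :: ('v, 'a::ab_group_add) mfps)"
  by (rule mfps_eqI) simp

lemma monom_diff: "monom \<mu> (c - d) = (monom \<mu> c - monom \<mu> d :: ('v, 'a::ab_group_add) mfps)"
  by (rule mfps_eqI) simp

lemma monom_sum: "monom \<mu> (\<Sum>i\<in>A. w i) = (\<Sum>i\<in>A. monom \<mu> (w i) :: ('v, 'a::ab_group_add) mfps)"
  by (rule mfps_eqI) (simp add: mfps_nth_sum)

lemma monom_mult_monom: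
  "monom \<mu> c * monom \<nu> d = (monom (\<mu> + \<nu>) (c * d) :: ('v::finite, 'a::comm_ring_1) mfps)"
proof (rule mfps_eqI)
  fix \<kappa> :: "'v \<Rightarrow> nat"
  have "mfps_nth (monom \<mu> c * monom \<nu> d) \<kappa> =
      (\<Sum>p | fst p + snd p = \<kappa>. if p = (\<mu>, \<nu>) then c * d else 0)"
    unfolding mfps_nth_mult by (rule sum.cong) (auto split: if_splits)
  also have "\<dots> = mfps_nth (monom (\<mu> + \<nu>) (c * d)) \<kappa>"
    using finite_exponent_splits[of \<kappa>] by (subst sum.delta) (auto simp: case_prod_unfold)
  finally show "mfps_nth (monom \<mu> c * monom \<nu> d) \<kappa> = mfps_nth (monom (\<mu> + \<nu>) (c * d)) \<kappa>" .
qed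

text \<open>A monomial vanishes away from its exponent, so finite fibres of \<open>E\<close> suffice
  for any coefficients; cancellation never enters.\<close>

lemma summable_on_monom:
  assumes "\<And>\<mu>. finite {i\<in>A. E i = \<mu>}"
  shows "(\<lambda>i. monom (E i) (w i)) summable_on A"
  by (rule summable_on_mfps, rule finite_subset[OF _ assms]) (auto split: if_splits)

lemma mfps_nth_has_sum_monom:
  assumes "((\<lambda>i. monom (E i) (w i)) has_sum s) A" "finite {i\<in>A. E i = \<mu>}"
  shows "mfps_nth s \<mu> = (\<Sum>i | i \<in> A \<and> E i = \<mu>. w i)"
proof -
  have "mfps_nth s \<mu> = (\<Sum>i | i \<in> A \<and> E i = \<mu>. mfps_nth (monom (E i) (w i)) \<mu>)"
    by (rule mfps_nth_has_sum[OF assms]) auto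
  then show ?thesis by simp
qed

lemma has_sum_monom_self:
  "((\<lambda>\<nu>. monom \<nu> (mfps_nth g \<nu>)) has_sum g) UNIV"
proof -
  have fin: "finite {\<nu>\<in>UNIV. \<nu> = \<mu>}" for \<mu> :: "'a \<Rightarrow> nat" by simp
  let ?h = "\<lambda>\<nu>. monom \<nu> (mfps_nth g \<nu>)"
  obtain s where s: "(?h has_sum s) UNIV"
    using summable_on_monom[of UNIV "\<lambda>\<nu>. \<nu>" "mfps_nth g"] by (auto simp: summable_on_def)
  have "s = g"
  proof (rule mfps_eqI)
    fix \<mu>
    show "mfps_nth s \<mu> = mfps_nth g \<mu>"
      using mfps_nth_has_sum_monom[OF s fin, of \<mu>] by simp
  qed
  with s show ?thesis by simp
qed


section \<open>Substitutions\<close>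

lemma subst_exponent_add: "subst_exponent a b (\<mu> + \<nu>) = subst_exponent a b \<mu> + subst_exponent a b \<nu>"
  by (auto simp: subst_exponent_def fun_eq_iff algebra_simps sum.distrib split: indet.splits)

lemma subst_exponent_0 [simp]: "subst_exponent a b 0 = 0"
  by (auto simp: subst_exponent_def fun_eq_iff split: indet.splits)

lemma subst_exponent_sum_list:
  "subst_exponent a b (sum_list \<nu>s) = sum_list (map (subst_exponent a b) \<nu>s)"
proof (induction \<nu>s)
  case (Cons \<nu> \<nu>s)
  then show ?case by (simp only: sum_list.Cons list.map subst_exponent_add)
qed (simp only: sum_list.Nil list.map subst_exponent_0)

lemma subst_exponent_id [simp]: "subst_exponent (\<lambda>_. 0) (\<lambda>_. Suc 0) \<nu> = \<nu>"
  by (auto simp: subst_exponent_def fun_eq_iff split: indet.splits)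

lemma subst_exponent_X [simp]: "subst_exponent a b \<nu> X_var = \<nu> X_var"
  by (simp add: subst_exponent_def)

text \<open>Replacing r by q^a' r^b' in q^a r^b gives q^(a + b a') r^(b b').\<close>

lemma subst_exponent_subst_exponent:
  "subst_exponent a' b' (subst_exponent a b \<nu>) =
    subst_exponent (\<lambda>i. a i + b i * a' i) (\<lambda>i. b i * b' i) \<nu>"
  by (auto simp: subst_exponent_def fun_eq_iff algebra_simps sum.distrib split: indet.splits)

text \<open>\<open>subst_r\<close> is 0 by default where its sum diverges. The relation records
  value and convergence together, so it is preserved by sums, differences and multiplication by
  powers of x.\<close>

definition has_subst ::
    "('m::finite \<Rightarrow> nat) \<Rightarrow> ('m \<Rightarrow> nat) \<Rightarrow> ('m indet, 'a::comm_ring_1) mfps \<Rightarrow>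
      ('m indet, 'a) mfps \<Rightarrow> bool" where
  "has_subst a b G H \<longleftrightarrow>
    ((\<lambda>\<nu>. monom (subst_exponent a b \<nu>) (mfps_nth G \<nu>)) has_sum H) UNIV"

lemma has_subst_subst_r: "substitutable a b G \<Longrightarrow> has_subst a b G (subst_r a b G)"
  by (simp add: substitutable_def has_subst_def subst_r_def)

lemma subst_r_eqI: "has_subst a b G H \<Longrightarrow> subst_r a b G = H"
  by (simp add: subst_r_def has_subst_def infsumI)

lemma has_subst_0: "has_subst a b 0 0"
  by (simp add: has_subst_def)

lemma has_subst_add:
  "has_subst a b G H \<Longrightarrow> has_subst a b G' H' \<Longrightarrow> has_subst a b (G + G') (H + H')"
  unfolding has_subst_def
  by (drule (1) has_sum_add, erule has_sum_cong[THEN iffD1, rotated]) (auto intro: mfps_eqI)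

lemma has_subst_diff:
  "has_subst a b G H \<Longrightarrow> has_subst a b G' H' \<Longrightarrow> has_subst a b (G - G') (H - H')"
  using has_sum_add[of "\<lambda>\<nu>. monom (subst_exponent a b \<nu>) (mfps_nth G \<nu>)" UNIV H
      "\<lambda>\<nu>. - monom (subst_exponent a b \<nu>) (mfps_nth G' \<nu>)" "- H'"]
  by (simp add: has_subst_def monom_diff has_sum_uminus)

lemma has_subst_sum:
  "(\<And>n. n \<in> A \<Longrightarrow> has_subst a b (G n) (H n)) \<Longrightarrow> has_subst a b (sum G A) (sum H A)"
  by (induction A rule: infinite_finite_induct) (simp_all add: has_subst_0 has_subst_add)

section \<open>Multiplication by powers of x\<close>

definition X_exponent :: "'m indet \<Rightarrow> nat" where
  "X_exponent = (\<lambda>w. if w = X_var then 1 else 0)"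

lemma X_power_eq_monom:
  "mvar X_var ^ n = (monom (\<lambda>w. n * X_exponent w) 1 :: ('m::finite indet, 'a::comm_ring_1) mfps)"
proof (induction n)
  case 0
  show ?case by (simp add: one_mfps_def zero_fun_def)
next
  case (Suc n)
  have "X_exponent + (\<lambda>w. n * X_exponent w) = (\<lambda>w :: 'm indet. Suc n * X_exponent w)"
    by (auto simp: fun_eq_iff)
  then show ?case
    unfolding power_Suc Suc
    by (simp only: mvar_def X_exponent_def[symmetric] monom_mult_monom mult_1)
qed

text \<open>Multiplying the monomials of \<open>G\<close> by a power of x shifts their exponents
  injectively, so no two of them meet at the same exponent.\<close>

lemma mfps_nth_X_power_mult:
  fixes G :: "('m::finite indet, 'a::comm_ring_1) mfps"
  shows "mfps_nth (mvar X_var ^ n * G) ((\<lambda>w. n * X_exponent w) + \<nu>) = mfps_nth G \<nu>"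
    and "\<mu> \<notin> range (\<lambda>\<nu>. (\<lambda>w. n * X_exponent w) + \<nu>) \<Longrightarrow> mfps_nth (mvar X_var ^ n * G) \<mu> = 0"
proof -
  let ?X = "\<lambda>w :: 'm indet. n * X_exponent w"
  have s: "((\<lambda>\<nu>. monom (?X + \<nu>) (mfps_nth G \<nu>)) has_sum (mvar X_var ^ n * G)) UNIV"
    using has_sum_cmult_right[OF has_sum_monom_self[of G], of "monom ?X 1"]
    by (simp add: X_power_eq_monom monom_mult_monom)
  show "mfps_nth (mvar X_var ^ n * G) (?X + \<nu>) = mfps_nth G \<nu>"
    using mfps_nth_has_sum_monom[OF s, of "?X + \<nu>"] by simp
  show "mfps_nth (mvar X_var ^ n * G) \<mu> = 0" if "\<mu> \<notin> range (\<lambda>\<nu>. ?X + \<nu>)"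
    using that by (intro mfps_nth_has_sum_eq_0[OF s]) auto
qed

lemma mfps_nth_X_power_mult_eq_0:
  fixes G :: "('m::finite indet, 'a::comm_ring_1) mfps"
  assumes "\<mu> X_var < n"
  shows "mfps_nth (mvar X_var ^ n * G) \<mu> = 0"
  using assms by (intro mfps_nth_X_power_mult(2)) (auto simp: X_exponent_def)

text \<open>A substitution fixes x and is additive on exponents, hence commutes with the shift. The
  defining sum is reindexed along the shift, and the exponents outside its range have coefficient
  zero.\<close>

lemma has_subst_X_power_mult:
  fixes G :: "('m::finite indet, 'a::comm_ring_1) mfps"
  assumes "has_subst a b G H"
  shows "has_subst a b (mvar X_var ^ n * G) (mvar X_var ^ n * H)"
proof -
  let ?X = "\<lambda>w :: 'm indet. n * X_exponent w"
  let ?t = "\<lambda>\<nu>. monom (subst_exponent a b \<nu>) (mfps_nth (mvar X_var ^ n * G) \<nu>)"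
  have "subst_exponent a b ?X = ?X"
    by (auto simp: subst_exponent_def X_exponent_def fun_eq_iff split: indet.splits)
  then have "((\<lambda>\<nu>. ?t (?X + \<nu>)) has_sum (mvar X_var ^ n * H)) UNIV"
    using has_sum_cmult_right[OF assms[unfolded has_subst_def], of "monom ?X 1"]
    by (simp add: X_power_eq_monom[symmetric] monom_mult_monom subst_exponent_add
        mfps_nth_X_power_mult(1)) (simp add: X_power_eq_monom monom_mult_monom)
  then have "(?t has_sum (mvar X_var ^ n * H)) (range (\<lambda>\<nu>. ?X + \<nu>))"
    by (subst has_sum_reindex) (auto simp: o_def inj_on_def)
  then show ?thesis
    unfolding has_subst_def
    by (rule has_sum_cong_neutral[THEN iffD1, rotated 3]) (auto simp: mfps_nth_X_power_mult(2))
qed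

text \<open>The family of substituted monomials is grouped by the original exponent. Each group is
  finite and adds up to one substituted monomial of \<open>T\<close>. Convergence of the ungrouped
  family makes the regrouping legitimate.\<close>

lemma has_subst_has_sum_monom:
  fixes w :: "'i \<Rightarrow> 'a::comm_ring_1"
  assumes T: "((\<lambda>i. monom (E i) (w i)) has_sum T) A"
    and U: "((\<lambda>i. monom (subst_exponent a b (E i)) (w i)) has_sum U) A"
    and fin: "\<And>\<mu>. finite {i\<in>A. E i = \<mu>}"
  shows "has_subst a b T U"
  unfolding has_subst_def
proof (rule has_sum_SigmaD)
  let ?g = "\<lambda>p. monom (subst_exponent a b (fst p)) (w (snd p))"
  show "(?g has_sum U) (SIGMA \<mu>:UNIV. {i\<in>A. E i = \<mu>})"
    using U by (rule has_sum_reindex_bij_witness[of _ "\<lambda>i. (E i, i)" snd, THEN iffD2, rotated -1]) auto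
  fix \<mu>
  have "((\<lambda>i. ?g (\<mu>, i)) has_sum (\<Sum>i\<in>{i\<in>A. E i = \<mu>}. ?g (\<mu>, i))) {i\<in>A. E i = \<mu>}"
    using fin by (rule has_sum_finite)
  then show "((\<lambda>i. ?g (\<mu>, i)) has_sum monom (subst_exponent a b \<mu>) (mfps_nth T \<mu>)) {i\<in>A. E i = \<mu>}"
    by (simp add: mfps_nth_has_sum_monom[OF T fin] monom_sum)
qed


section \<open>Products of substituted series\<close>

text \<open>
  A list of triples \<open>((a, b), g)\<close> stands for the product of the series \<open>subst_r a b g\<close>; expanding
  it means choosing an exponent vector from the support of every \<open>g\<close>.
\<close>

type_synonym ('m, 'a) subst_list = "((('m \<Rightarrow> nat) \<times> ('m \<Rightarrow> nat)) \<times> ('m indet, 'a) mfps) list"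

definition choices :: "('m::finite, 'a::comm_ring_1) subst_list \<Rightarrow> ('m indet \<Rightarrow> nat) list set" where
  "choices ps = {\<nu>s. list_all2 (\<lambda>p \<nu>. mfps_nth (snd p) \<nu> \<noteq> 0) ps \<nu>s}"

definition choice_exponent ::
    "('m::finite, 'a::comm_ring_1) subst_list \<Rightarrow> ('m indet \<Rightarrow> nat) list \<Rightarrow> ('m indet \<Rightarrow> nat)" where
  "choice_exponent ps \<nu>s =
    sum_list (map2 (\<lambda>p. subst_exponent (fst (fst p)) (snd (fst p))) ps \<nu>s)"

definition choice_coeff ::
    "('m::finite, 'a::comm_ring_1) subst_list \<Rightarrow> ('m indet \<Rightarrow> nat) list \<Rightarrow> 'a" where
  "choice_coeff ps \<nu>s = prod_list (map2 (\<lambda>p. mfps_nth (snd p)) ps \<nu>s)"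

definition subst_prod :: "('m::finite, 'a::comm_ring_1) subst_list \<Rightarrow> ('m indet, 'a) mfps" where
  "subst_prod ps = prod_list (map (\<lambda>p. subst_r (fst (fst p)) (snd (fst p)) (snd p)) ps)"

lemma choices_Nil: "choices [] = {[]}"
  by (auto simp: choices_def)

lemma choices_Cons:
  "choices (p # ps) = (\<lambda>(\<nu>, \<nu>s). \<nu> # \<nu>s) ` ({\<nu>. mfps_nth (snd p) \<nu> \<noteq> 0} \<times> choices ps)"
  by (auto simp: choices_def list_all2_Cons1)

lemma choice_exponent_Nil [simp]: "choice_exponent [] \<nu>s = 0"
  by (simp add: choice_exponent_def)

lemma choice_exponent_Cons [simp]:
  "choice_exponent ((ab, g) # ps) (\<nu> # \<nu>s) =
    subst_exponent (fst ab) (snd ab) \<nu> + choice_exponent ps \<nu>s"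
  unfolding choice_exponent_def zip_Cons_Cons list.map sum_list.Cons prod.case fst_conv ..

lemma choice_coeff_Nil [simp]: "choice_coeff [] \<nu>s = 1"
  by (simp add: choice_coeff_def)

lemma choice_coeff_Cons [simp]:
  "choice_coeff ((ab, g) # ps) (\<nu> # \<nu>s) = mfps_nth g \<nu> * choice_coeff ps \<nu>s"
  by (simp add: choice_coeff_def)

text \<open>By induction on the list, each step distributes a product of two convergent sums over
  pairs of choices. The difficulty is to obtain convergence of the two factors from finiteness for
  the whole list only.\<close>

lemma has_sum_subst_prod:
  fixes ps :: "('m::finite, 'a::comm_ring_1) subst_list"
  assumes "\<And>\<mu>. finite {\<nu>s\<in>choices ps. choice_exponent ps \<nu>s = \<mu>}"
  shows "((\<lambda>\<nu>s. monom (choice_exponent ps \<nu>s) (choice_coeff ps \<nu>s)) has_sum subst_prod ps) (choices ps)"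
  using assms
proof (induction ps)
  case Nil
  show ?case
    by (rule has_sum_finiteI) (simp_all add: choices_Nil subst_prod_def one_mfps_def zero_fun_def del: sum_constant)
next
  case (Cons p ps)
  obtain a b g where p: "p = ((a, b), g)" by (metis prod.exhaust)
  let ?N = "{\<nu>. mfps_nth g \<nu> \<noteq> 0}"
  let ?E = "choice_exponent ps" and ?c = "choice_coeff ps"
  have fin_Cons: "finite {p\<in>?N \<times> choices ps. subst_exponent a b (fst p) + ?E (snd p) = \<mu>}" for \<mu>
  proof -
    have "{\<nu>s\<in>choices (p # ps). choice_exponent (p # ps) \<nu>s = \<mu>} =
        (\<lambda>(\<nu>, \<nu>s). \<nu> # \<nu>s) ` {p\<in>?N \<times> choices ps. subst_exponent a b (fst p) + ?E (snd p) = \<mu>}"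
      by (auto simp: choices_Cons p)
    then show ?thesis
      using Cons.prems[of \<mu>] by (auto simp: inj_on_def dest!: finite_imageD)
  qed
  have prod: "subst_prod (p # ps) = subst_r a b g * subst_prod ps"
    by (simp add: subst_prod_def p)
  show ?case
  \<comment> \<open>If one side offers no choice, the finiteness condition says nothing about the
    other, whose substitution may diverge. The product is then zero anyway.\<close>
  proof (cases "?N = {} \<or> choices ps = {}")
    case True
    then have "subst_prod (p # ps) = 0"
    proof
      assume "?N = {}"
      then have "g = 0" by (auto intro: mfps_eqI)
      then show ?thesis
        by (simp add: prod subst_r_eqI[OF has_subst_0])
    next
      assume "choices ps = {}"
      with Cons.IH have "subst_prod ps = 0" by (auto dest: infsumI)
      then show ?thesis by (simp add: prod)
    qed
    moreover have "choices (p # ps) = {}"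
      using True by (auto simp: choices_Cons p)
    ultimately show ?thesis by simp
  next
    case False
    then obtain \<nu>\<^sub>0 \<nu>s\<^sub>0 where 0: "\<nu>\<^sub>0 \<in> ?N" "\<nu>s\<^sub>0 \<in> choices ps" by blast
    \<comment> \<open>Pairing with the fixed choice \<open>\<nu>s\<^sub>0\<close> embeds each fibre
      of the first factor into a fibre of the whole list; \<open>fin_ps\<close> uses
      \<open>\<nu>\<^sub>0\<close> in the same way.\<close>
    have fin_g: "finite {\<nu>\<in>?N. subst_exponent a b \<nu> = \<mu>}" for \<mu>
      by (rule finite_subset[OF _ finite_imageI[OF fin_Cons[of "\<mu> + ?E \<nu>s\<^sub>0"], of fst]])
        (use 0 in force)
    have fin_ps: "finite {\<nu>s\<in>choices ps. ?E \<nu>s = \<mu>}" for \<mu>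
      by (rule finite_subset[OF _ finite_imageI[OF fin_Cons[of "subst_exponent a b \<nu>\<^sub>0 + \<mu>"], of snd]])
        (use 0 in force)
    have IH: "((\<lambda>\<nu>s. monom (?E \<nu>s) (?c \<nu>s)) has_sum subst_prod ps) (choices ps)"
      using fin_ps by (rule Cons.IH)
    obtain G where G: "((\<lambda>\<nu>. monom (subst_exponent a b \<nu>) (mfps_nth g \<nu>)) has_sum G) ?N"
      using summable_on_monom[OF fin_g, of "mfps_nth g"] by (auto simp: summable_on_def)
    then have "has_subst a b g G"
      unfolding has_subst_def by (rule has_sum_cong_neutral[THEN iffD1, rotated 3]) auto
    then have G_eq: "G = subst_r a b g" by (rule subst_r_eqI[symmetric])
    let ?h = "\<lambda>(\<nu>, \<nu>s). monom (subst_exponent a b \<nu> + ?E \<nu>s) (mfps_nth g \<nu> * ?c \<nu>s)"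
    have "?h summable_on ?N \<times> choices ps"
      unfolding case_prod_unfold using fin_Cons by (rule summable_on_monom)
    then obtain s where s: "(?h has_sum s) (?N \<times> choices ps)"
      by (auto simp: summable_on_def)
    \<comment> \<open>Summing over the choices for the tail first turns the double sum into a sum
      with the constant factor \<open>subst_prod ps\<close>.\<close>
    have "((\<lambda>\<nu>. monom (subst_exponent a b \<nu>) (mfps_nth g \<nu>) * subst_prod ps) has_sum s) ?N"
      by (rule has_sum_SigmaD[OF s]) (auto simp: monom_mult_monom[symmetric] intro: has_sum_cmult_right IH)
    moreover have "((\<lambda>\<nu>. monom (subst_exponent a b \<nu>) (mfps_nth g \<nu>) * subst_prod ps) has_sum
        subst_prod (p # ps)) ?N"
      using has_sum_cmult_left[OF G, of "subst_prod ps"] by (simp add: prod G_eq)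
    ultimately have "s = subst_prod (p # ps)" by (rule has_sum_unique)
    with s show ?thesis
      unfolding choices_Cons
      by (subst has_sum_reindex)
        (auto simp: p inj_on_def o_def case_prod_unfold)
  qed
qed


section \<open>Prepending a tuple to a sequence\<close>

definition factors ::
    "('m::finite indet, 'a::comm_ring_1) mfps \<Rightarrow> (('m \<Rightarrow> int) \<Rightarrow> ('m indet, 'a) mfps) \<Rightarrow>
      ('m \<Rightarrow> int) list \<Rightarrow> ('m, 'a) subst_list" where
  "factors e f J =
    map (\<lambda>k. ((a_exp J k, b_exp J k), if k \<le> length J then f (J ! (k - 1)) else e)) [1..<length J + 2]"

text \<open>By the composition formula, these are the exponents of the substitution
  \<open>ab\<close> followed by that of \<open>j\<close>.\<close>

definition prepend_step ::
    "('m \<Rightarrow> int) \<Rightarrow> ('m \<Rightarrow> nat) \<times> ('m \<Rightarrow> nat) \<Rightarrow> ('m \<Rightarrow> nat) \<times> ('m \<Rightarrow> nat)" where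
  "prepend_step j ab = ((\<lambda>i. fst ab i + snd ab i * step_q j i), (\<lambda>i. snd ab i * step_r j i))"

lemma subst_exponent_prepend_step:
  "subst_exponent (fst (prepend_step j ab)) (snd (prepend_step j ab)) \<nu> =
    subst_exponent (step_q j) (step_r j) (subst_exponent (fst ab) (snd ab) \<nu>)"
  by (simp add: prepend_step_def subst_exponent_subst_exponent)

lemma a_exp_b_exp_1: "a_exp J (Suc 0) = (\<lambda>_. 0)" "b_exp J (Suc 0) = (\<lambda>_. 1)"
  by (auto simp: a_exp_def b_exp_def entries_def)

text \<open>If \<open>t\<close> does not occur, \<open>takeWhile\<close> never stops and the default
  is the whole list.\<close>

lemma after_last_Cons: "after_last t (x # xs) = (if t \<in> set xs then after_last t xs else
    if x = t then xs else x # xs)"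
  by (auto simp: after_last_def takeWhile_append takeWhile_eq_all_conv)

text \<open>If -1 occurs among the later entries, the new first entry is invisible, and
  \<open>b_exp J k i = 0\<close> discards the step. Otherwise a nonnegative entry is added to the
  sum, while -1 leaves the sum unchanged and makes b vanish. The lower bound keeps sums without -1
  nonnegative, where \<open>nat\<close> is additive.\<close>

lemma a_exp_b_exp_Cons:
  fixes j :: "'m::finite \<Rightarrow> int"
  assumes "\<forall>j'\<in>set (j # J). \<forall>i. j' i \<ge> -1" "k \<ge> 1"
  shows "(a_exp (j # J) (Suc k), b_exp (j # J) (Suc k)) = prepend_step j (a_exp J k, b_exp J k)"
proof -
  have entries: "entries (j # J) i (Suc k) = j i # entries J i k" for i
    using assms(2) by (cases k) (simp_all add: entries_def)
  have sum: "sum_list (entries J i k) \<ge> 0" if "-1 \<notin> set (entries J i k)" for i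
  proof (rule sum_list_nonneg)
    fix t assume t: "t \<in> set (entries J i k)"
    then have "t \<ge> -1" using assms(1) by (auto simp: entries_def dest: in_set_takeD)
    moreover have "t \<noteq> -1" using t that by auto
    ultimately show "t \<ge> 0" by simp
  qed
  have j: "j i = -1 \<or> j i \<ge> 0" for i
  proof -
    have "j i \<ge> -1" using assms(1) by simp
    then show ?thesis by linarith
  qed
  have "a_exp (j # J) (Suc k) i = a_exp J k i + b_exp J k i * step_q j i"
    "b_exp (j # J) (Suc k) i = b_exp J k i * step_r j i" for i
    using sum[of i] j[of i]
    by (auto simp: a_exp_def b_exp_def entries after_last_Cons step_q_def step_r_def eps_def
        nat_add_distrib)
  then show ?thesis
    by (simp add: prepend_step_def fun_eq_iff)
qed

lemma factors_Cons:
  fixes j :: "'m::finite \<Rightarrow> int"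
  assumes "\<forall>j'\<in>set (j # J). \<forall>i. j' i \<ge> -1"
  shows "factors e f (j # J) = ((\<lambda>_. 0, \<lambda>_. 1), f j) # map (apfst (prepend_step j)) (factors e f J)"
proof -
  have "[1..<length (j # J) + 2] = 1 # map Suc [1..<length J + 2]"
    by (simp add: upt_conv_Cons map_Suc_upt del: upt_Suc)
  then show ?thesis
    using a_exp_b_exp_Cons[OF assms]
    by (auto simp: factors_def a_exp_b_exp_1 simp del: upt_Suc)
qed

lemma choices_map_apfst: "choices (map (apfst h) ps) = choices ps"
  by (simp add: choices_def list_all2_map1)

text \<open>Additivity on exponents lets the substitution common to all factors act once on the
  total exponent.\<close>

lemma choice_exponent_prepend_step:
  "choice_exponent (map (apfst (prepend_step j)) ps) \<nu>s =
    subst_exponent (step_q j) (step_r j) (choice_exponent ps \<nu>s)"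
  unfolding choice_exponent_def subst_exponent_sum_list
  by (simp add: zip_map1 comp_def case_prod_unfold subst_exponent_prepend_step)

lemma choice_coeff_map_apfst: "choice_coeff (map (apfst h) ps) \<nu>s = choice_coeff ps \<nu>s"
  by (simp add: choice_coeff_def zip_map1 comp_def case_prod_unfold)

lemma subst_prod_factors: "subst_prod (factors e f J) = seq_term e f J"
proof -
  have "[1..<length J + 2] = [1..<length J + 1] @ [length J + 1]" by simp
  moreover have "(\<Prod>k=1..length J. h k) = prod_list (map h [1..<length J + 1])"
    for h :: "nat \<Rightarrow> ('a indet, 'b) mfps"
    by (simp add: prod.distinct_set_conv_list[symmetric] atLeastLessThanSuc_atLeastAtMost del: upt_Suc)
  ultimately show ?thesis
    unfolding subst_prod_def factors_def seq_term_def
    by (auto simp: mult.commute comp_def simp del: upt_Suc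
        intro!: arg_cong[where f = prod_list] arg_cong2[where f = "(*)"])
qed

text \<open>This presents the contributions as a fibre of an exponent map, so that the convergence
  hypothesis feeds \<open>summable_on_monom\<close>. The work is the passage from positions counted
  from 1 to list indices counted from 0.\<close>

lemma contributions_eq:
  "contributions \<J> e f n \<mu> = {c\<in>SIGMA J:sequences \<J> n. choices (factors e f J).
    choice_exponent (factors e f (fst c)) (snd c) = \<mu>}"
proof -
  have len: "length (factors e f J) = n + 1" if "length J = n" for J
    using that by (simp add: factors_def)
  have nth: "factors e f J ! k = ((a_exp J (k + 1), b_exp J (k + 1)), if k < n then f (J ! k) else e)"
    if "length J = n" "k < n + 1" for J k
    using that by (simp add: factors_def del: upt_Suc)
  have 1: "\<nu>s \<in> choices (factors e f J) \<longleftrightarrow> length \<nu>s = n + 1 \<and>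
      (\<forall>k\<in>{1..n}. mfps_nth (f (J ! (k - 1))) (\<nu>s ! (k - 1)) \<noteq> 0) \<and> mfps_nth e (\<nu>s ! n) \<noteq> 0"
    if J: "length J = n" for J \<nu>s
  proof -
    have "\<nu>s \<in> choices (factors e f J) \<longleftrightarrow> length \<nu>s = n + 1 \<and>
      (\<forall>k<n + 1. mfps_nth (if k < n then f (J ! k) else e) (\<nu>s ! k) \<noteq> 0)"
      using nth[OF J] by (auto simp: choices_def list_all2_conv_all_nth len[OF J])
    also have "(\<forall>k<n + 1. mfps_nth (if k < n then f (J ! k) else e) (\<nu>s ! k) \<noteq> 0) \<longleftrightarrow>
        (\<forall>k<n. mfps_nth (f (J ! k)) (\<nu>s ! k) \<noteq> 0) \<and> mfps_nth e (\<nu>s ! n) \<noteq> 0"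
      by (auto simp: less_Suc_eq)
    also have "(\<forall>k<n. mfps_nth (f (J ! k)) (\<nu>s ! k) \<noteq> 0) \<longleftrightarrow>
        (\<forall>k\<in>{1..n}. mfps_nth (f (J ! (k - 1))) (\<nu>s ! (k - 1)) \<noteq> 0)"
      unfolding image_Suc_lessThan[symmetric] by auto
    finally show ?thesis .
  qed
  have 2: "choice_exponent (factors e f J) \<nu>s =
      (\<Sum>k=1..n + 1. subst_exponent (a_exp J k) (b_exp J k) (\<nu>s ! (k - 1)))"
    if "length J = n" "length \<nu>s = n + 1" for J \<nu>s
  proof -
    have "choice_exponent (factors e f J) \<nu>s =
        (\<Sum>k = 0..<n + 1. subst_exponent (a_exp J (k + 1)) (b_exp J (k + 1)) (\<nu>s ! k))"
      unfolding choice_exponent_def sum_list_sum_nth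
      using that len nth by (intro sum.cong) (auto simp: len nth)
    also have "\<dots> = (\<Sum>k=1..n + 1. subst_exponent (a_exp J k) (b_exp J k) (\<nu>s ! (k - 1)))"
      by (rule sum.reindex_bij_witness[where i = "\<lambda>k. k - 1" and j = Suc]) auto
    finally show ?thesis .
  qed
  show ?thesis
    unfolding contributions_def by (auto simp: sequences_def 1 2)
qed


section \<open>The expansion\<close>

definition expansion_term ::
    "('m::finite \<Rightarrow> int) set \<Rightarrow> ('m indet, 'a::comm_ring_1) mfps \<Rightarrow>
      (('m \<Rightarrow> int) \<Rightarrow> ('m indet, 'a) mfps) \<Rightarrow> nat \<Rightarrow> ('m indet, 'a) mfps" where
  "expansion_term \<J> e f n = (\<Sum>\<^sub>\<infinity>J\<in>sequences \<J> n. seq_term e f J)"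

text \<open>The family of all contributions is summable by finiteness of the fibres; grouping it by
  \<open>J\<close> yields the sum of the \<open>seq_term\<close>s.\<close>

lemma has_sum_expansion_term:
  assumes "expansion_converges \<J> e f"
  shows "((\<lambda>(J, \<nu>s). monom (choice_exponent (factors e f J) \<nu>s) (choice_coeff (factors e f J) \<nu>s))
      has_sum expansion_term \<J> e f n) (SIGMA J:sequences \<J> n. choices (factors e f J))"
    and "(seq_term e f has_sum expansion_term \<J> e f n) (sequences \<J> n)"
proof -
  let ?A = "SIGMA J:sequences \<J> n. choices (factors e f J)"
  let ?g = "\<lambda>(J, \<nu>s). monom (choice_exponent (factors e f J) \<nu>s) (choice_coeff (factors e f J) \<nu>s)"
  have fin: "finite {c\<in>?A. choice_exponent (factors e f (fst c)) (snd c) = \<mu>}" for \<mu>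
    using assms by (simp only: expansion_converges_def contributions_eq)
  have "?g summable_on ?A"
    unfolding case_prod_unfold using fin by (rule summable_on_monom)
  then obtain s where s: "(?g has_sum s) ?A"
    by (auto simp: summable_on_def)
  have seq: "(seq_term e f has_sum s) (sequences \<J> n)"
  proof (rule has_sum_SigmaD[OF s])
    fix J assume J: "J \<in> sequences \<J> n"
    have "finite {\<nu>s\<in>choices (factors e f J). choice_exponent (factors e f J) \<nu>s = \<mu>}" for \<mu>
      by (rule finite_subset[OF _ finite_imageI[OF fin[of \<mu>], of snd]]) (use J in force)
    from has_sum_subst_prod[OF this]
    show "((\<lambda>\<nu>s. ?g (J, \<nu>s)) has_sum seq_term e f J) (choices (factors e f J))"
      by (simp add: subst_prod_factors)
  qed
  then have "expansion_term \<J> e f n = s"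
    unfolding expansion_term_def by (rule infsumI)
  with s seq show "(?g has_sum expansion_term \<J> e f n) ?A"
    "(seq_term e f has_sum expansion_term \<J> e f n) (sequences \<J> n)"
    by simp_all
qed

lemma expansion_term_0:
  assumes "expansion_converges \<J> e f"
  shows "expansion_term \<J> e f 0 = e"
proof -
  have "has_subst (\<lambda>_. 0) (\<lambda>_. 1) e e"
    by (simp add: has_subst_def has_sum_monom_self)
  then have "seq_term e f [] = e"
    by (simp add: seq_term_def a_exp_b_exp_1 subst_r_eqI)
  moreover have "sequences \<J> 0 = {[]}" by (auto simp: sequences_def)
  ultimately show ?thesis by (simp add: expansion_term_def)
qed

text \<open>
  A nonzero \<open>f j\<close> contributes some monomial, so that every contribution to the substituted
  term of order \<open>n\<close> is visible as one to the term of order \<open>Suc n\<close>.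
\<close>

lemma expansion_term_Suc:
  fixes \<J> :: "('m::finite \<Rightarrow> int) set"
    and f :: "('m \<Rightarrow> int) \<Rightarrow> ('m indet, 'a::comm_ring_1) mfps"
  assumes ge: "\<forall>j\<in>\<J>. \<forall>i. j i \<ge> -1"
    and conv: "expansion_converges \<J> e f"
  obtains U where
    "\<And>j. j \<in> \<J> \<Longrightarrow> f j \<noteq> 0 \<Longrightarrow> has_subst (step_q j) (step_r j) (expansion_term \<J> e f n) (U j)"
    "((\<lambda>j. f j * U j) has_sum expansion_term \<J> e f (Suc n)) \<J>"
proof -
  let ?A = "\<lambda>n. SIGMA J:sequences \<J> n. choices (factors e f J)"
  let ?E = "\<lambda>(J, \<nu>s). choice_exponent (factors e f J) \<nu>s"
  let ?c = "\<lambda>(J, \<nu>s). choice_coeff (factors e f J) \<nu>s"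
  let ?S = "\<lambda>j. subst_exponent (step_q j) (step_r j)"
  let ?N = "\<lambda>j. {\<nu>. mfps_nth (f j) \<nu> \<noteq> 0}"
  let ?B = "SIGMA j:\<J>. ?N j \<times> ?A n"
  \<comment> \<open>A sequence of length \<open>Suc n\<close> with its choices splits uniquely into
    a first tuple, its exponent, and a sequence of length \<open>n\<close> with its choices.\<close>
  define cons :: "('m \<Rightarrow> int) \<times> ('m indet \<Rightarrow> nat) \<times> ('m \<Rightarrow> int) list \<times> ('m indet \<Rightarrow> nat) list \<Rightarrow> _"
    where "cons = (\<lambda>(j, \<nu>, J, \<nu>s). (j # J, \<nu> # \<nu>s))"
  \<comment> \<open>This is the substituted term of order \<open>n\<close>, summed before equal
    exponents are collected. Convergence is only shown for \<open>f j\<close> nonzero; otherwise the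
    product \<open>f j * U j\<close> is zero whatever the value.\<close>
  define U where "U j = (\<Sum>\<^sub>\<infinity>c\<in>?A n. monom (?S j (?E c)) (?c c))" for j
  have ge_J: "\<forall>j'\<in>set (j # J). \<forall>i. j' i \<ge> -1" if "j \<in> \<J>" "J \<in> sequences \<J> n" for j J
    using that ge by (auto simp: sequences_def)
  have fin: "finite {c\<in>?A n. ?E c = \<mu>}" for n \<mu>
    unfolding case_prod_unfold using conv by (simp only: expansion_converges_def contributions_eq)
  have inj: "inj cons" by (auto simp: cons_def inj_on_def)
  have mem_Suc: "(j # J, \<nu> # \<nu>s) \<in> ?A (Suc n) \<longleftrightarrow> (j, \<nu>, J, \<nu>s) \<in> ?B" for j J \<nu> \<nu>s
  proof -
    have "choices (factors e f (j # J)) =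
        (\<lambda>(\<nu>, \<nu>s). \<nu> # \<nu>s) ` (?N j \<times> choices (factors e f J))"
      if "j \<in> \<J>" "J \<in> sequences \<J> n"
      using factors_Cons[OF ge_J[OF that], where e = e and f = f]
      by (simp add: choices_Cons choices_map_apfst)
    then show ?thesis by (auto simp: sequences_def)
  qed
  have image: "cons ` ?B = ?A (Suc n)"
  proof (intro equalityI subsetI)
    fix c assume c: "c \<in> ?A (Suc n)"
    then obtain J' \<nu>s' where c': "c = (J', \<nu>s')" "length J' = Suc n" "\<nu>s' \<in> choices (factors e f J')"
      by (auto simp: sequences_def)
    then have "length \<nu>s' = length (factors e f J')"
      by (auto simp: choices_def dest: list_all2_lengthD)
    then obtain j J \<nu> \<nu>s where "J' = j # J" "\<nu>s' = \<nu> # \<nu>s"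
      using c' by (cases J'; cases \<nu>s') (auto simp: factors_def)
    with c c' show "c \<in> cons ` ?B"
      using mem_Suc by (auto simp: cons_def image_iff)
  qed (use mem_Suc in \<open>auto simp: cons_def\<close>)
  have E: "?E (cons (j, \<nu>, c)) = \<nu> + ?S j (?E c)"
    and c: "?c (cons (j, \<nu>, c)) = mfps_nth (f j) \<nu> * ?c c"
    if "(j, \<nu>, c) \<in> ?B" for j \<nu> c
    using that factors_Cons[OF ge_J, of j "fst c", where e = e and f = f]
    by (auto simp: cons_def choice_exponent_prepend_step choice_coeff_map_apfst case_prod_unfold)
  \<comment> \<open>Injectivity of \<open>cons\<close> pulls finiteness back from order
    \<open>Suc n\<close>.\<close>
  have fin_B: "finite {(j, \<nu>, c)\<in>?B. \<nu> + ?S j (?E c) = \<mu>}" for \<mu>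
  proof (rule finite_imageD)
    show "finite (cons ` {(j, \<nu>, c)\<in>?B. \<nu> + ?S j (?E c) = \<mu>})"
    proof (rule finite_subset[OF _ fin[of "Suc n" \<mu>]], rule image_subsetI)
      fix b assume b: "b \<in> {(j, \<nu>, c)\<in>?B. \<nu> + ?S j (?E c) = \<mu>}"
      obtain j \<nu> c where eq: "b = (j, \<nu>, c)" by (metis prod.exhaust)
      from b have mem: "(j, \<nu>, c) \<in> ?B" and "\<nu> + ?S j (?E c) = \<mu>"
        unfolding eq by simp_all
      then have "?E (cons b) = \<mu>" using E[OF mem] by (simp only: eq)
      moreover have "cons b \<in> ?A (Suc n)" using mem unfolding eq image[symmetric] by (rule imageI)
      ultimately show "cons b \<in> {c\<in>?A (Suc n). ?E c = \<mu>}" by simp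
    qed
  qed (use inj in \<open>blast intro: inj_on_subset\<close>)
  have U: "((\<lambda>c. monom (?S j (?E c)) (?c c)) has_sum U j) (?A n)"
    if "j \<in> \<J>" "f j \<noteq> 0" for j
  proof -
    obtain \<nu> where \<nu>: "\<nu> \<in> ?N j"
      using \<open>f j \<noteq> 0\<close> by (auto simp: mfps_eq_iff)
    have "finite {c\<in>?A n. ?S j (?E c) = \<mu>}" for \<mu>
      by (rule finite_subset[OF _ finite_imageI[OF fin_B[of "\<nu> + \<mu>"], of "snd \<circ> snd"]])
        (use that \<nu> in force)
    then show ?thesis
      unfolding U_def by (intro has_sum_infsum summable_on_monom)
  qed
  show thesis
  proof
    fix j assume j: "j \<in> \<J>" "f j \<noteq> 0"
    show "has_subst (step_q j) (step_r j) (expansion_term \<J> e f n) (U j)"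
      using has_sum_expansion_term(1)[OF conv, of n] U[OF j] fin
      by (intro has_subst_has_sum_monom[where E = ?E and w = ?c and A = "?A n"])
        (simp_all add: case_prod_unfold)
  next
    have "((\<lambda>c. monom (?E c) (?c c)) has_sum expansion_term \<J> e f (Suc n)) (cons ` ?B)"
      using has_sum_expansion_term(1)[OF conv, of "Suc n"] by (simp add: image case_prod_unfold)
    then have "((\<lambda>b. monom (?E (cons b)) (?c (cons b))) has_sum expansion_term \<J> e f (Suc n)) ?B"
      by (subst (asm) has_sum_reindex[OF inj_on_subset[OF inj subset_UNIV]]) (simp add: o_def)
    moreover have "monom (?E (cons b)) (?c (cons b)) =
        (case b of (j, \<nu>, c) \<Rightarrow> monom \<nu> (mfps_nth (f j) \<nu>) * monom (?S j (?E c)) (?c c))"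
      if "b \<in> ?B" for b
    proof -
      obtain j \<nu> c where eq: "b = (j, \<nu>, c)" by (metis prod.exhaust)
      have mem: "(j, \<nu>, c) \<in> ?B" using that by (simp only: eq)
      show ?thesis
        unfolding eq prod.case E[OF mem] c[OF mem] monom_mult_monom ..
    qed
    ultimately have total: "((\<lambda>(j, \<nu>, c). monom \<nu> (mfps_nth (f j) \<nu>) * monom (?S j (?E c)) (?c c))
        has_sum expansion_term \<J> e f (Suc n)) ?B"
      by (rule has_sum_cong[THEN iffD1, rotated])
    show "((\<lambda>j. f j * U j) has_sum expansion_term \<J> e f (Suc n)) \<J>"
    proof (rule has_sum_SigmaD[OF total])
      fix j assume j: "j \<in> \<J>"
      show "((\<lambda>y. case (j, y) of (j, \<nu>, c) \<Rightarrow>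
          monom \<nu> (mfps_nth (f j) \<nu>) * monom (?S j (?E c)) (?c c)) has_sum f j * U j) (?N j \<times> ?A n)"
      proof (cases "f j = 0")
        case False
        let ?h = "\<lambda>(\<nu>, c). monom \<nu> (mfps_nth (f j) \<nu>) * monom (?S j (?E c)) (?c c)"
        have "finite {p\<in>?N j \<times> ?A n. fst p + ?S j (?E (snd p)) = \<mu>}" for \<mu>
          by (rule finite_subset[OF _ finite_imageI[OF fin_B[of \<mu>], of snd]]) (use j in force)
        then have "(\<lambda>p. monom (fst p + ?S j (?E (snd p))) (mfps_nth (f j) (fst p) * ?c (snd p)))
            summable_on ?N j \<times> ?A n"
          by (rule summable_on_monom)
        then have "?h summable_on ?N j \<times> ?A n"
          by (simp add: monom_mult_monom case_prod_unfold)
        then obtain s where s: "(?h has_sum s) (?N j \<times> ?A n)"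
          by (auto simp: summable_on_def)
        \<comment> \<open>Summing over \<open>c\<close> first produces the factor
          \<open>U j\<close>; the remaining sum over \<nu> is the monomial expansion of
          \<open>f j\<close>.\<close>
        have "((\<lambda>\<nu>. monom \<nu> (mfps_nth (f j) \<nu>) * U j) has_sum s) (?N j)"
          by (rule has_sum_SigmaD[OF s]) (use U[OF j False] in \<open>auto intro: has_sum_cmult_right\<close>)
        moreover have "((\<lambda>\<nu>. monom \<nu> (mfps_nth (f j) \<nu>) * U j) has_sum f j * U j) (?N j)"
          using has_sum_cmult_left[OF has_sum_monom_self[of "f j"], of "U j"]
          by (rule has_sum_cong_neutral[THEN iffD1, rotated 3]) auto
        ultimately have "s = f j * U j" by (rule has_sum_unique)
        with s show ?thesis by (simp add: case_prod_unfold)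
      qed simp
    qed
  qed
qed

theorem theorem2p1:
  fixes \<J> :: "('m::finite \<Rightarrow> int) set"
    and e F :: "('m indet, 'a::comm_ring_1) mfps"
    and f :: "('m \<Rightarrow> int) \<Rightarrow> ('m indet, 'a) mfps"
  assumes entries_ge: "\<And>j i. j \<in> \<J> \<Longrightarrow> j i \<ge> -1"
    and F_meaningful: "\<And>j. j \<in> \<J> \<Longrightarrow> substitutable (step_q j) (step_r j) F"
    and equation_meaningful:
      "(\<lambda>j. mvar X_var * f j * subst_r (step_q j) (step_r j) F) summable_on \<J>"
    and functional_equation:
      "F = e + (\<Sum>\<^sub>\<infinity>j\<in>\<J>. mvar X_var * f j * subst_r (step_q j) (step_r j) F)"
    and expansion_meaningful: "expansion_converges \<J> e f"
  shows "(\<forall>n. seq_term e f summable_on sequences \<J> n) \<and>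
    (\<lambda>n. mvar X_var ^ n * (\<Sum>\<^sub>\<infinity>J\<in>sequences \<J> n. seq_term e f J)) sums F"
proof (intro conjI allI)
  fix n
  show "seq_term e f summable_on sequences \<J> n"
    using has_sum_expansion_term(2)[OF expansion_meaningful] by (rule has_sum_imp_summable)
next
  let ?x = "mvar X_var :: ('m indet, 'a) mfps"
  let ?T = "expansion_term \<J> e f"
  have ge: "\<forall>j\<in>\<J>. \<forall>i. j i \<ge> -1"
    using entries_ge by blast
  have "\<exists>U. (\<forall>j\<in>\<J>. f j \<noteq> 0 \<longrightarrow> has_subst (step_q j) (step_r j) (?T n) (U j)) \<and>
      ((\<lambda>j. f j * U j) has_sum ?T (Suc n)) \<J>" for n
    by (rule expansion_term_Suc[OF ge expansion_meaningful, of n]) blast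
  then obtain U where
    U: "\<And>n j. j \<in> \<J> \<Longrightarrow> f j \<noteq> 0 \<Longrightarrow> has_subst (step_q j) (step_r j) (?T n) (U n j)"
    and T_Suc: "\<And>n. ((\<lambda>j. f j * U n j) has_sum ?T (Suc n)) \<J>"
    by metis
  define R where "R N = F - (\<Sum>n<N. ?x ^ n * ?T n)" for N
  \<comment> \<open>The image of \<open>R N\<close> under the substitution of \<open>j\<close>,
    assembled from the images of its summands; \<open>subst_R\<close> confirms this where
    \<open>f j\<close> is nonzero.\<close>
  define SR where "SR N j = subst_r (step_q j) (step_r j) F - (\<Sum>n<N. ?x ^ n * U n j)" for N j
  have subst_R: "has_subst (step_q j) (step_r j) (R N) (SR N j)" if "j \<in> \<J>" "f j \<noteq> 0" for N j
    unfolding R_def SR_def using that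
    by (intro has_subst_diff has_subst_sum has_subst_X_power_mult has_subst_subst_r U F_meaningful)
  \<comment> \<open>The base case is the functional equation, as the term of order 0 is
    \<open>e\<close>. The induction step subtracts \<open>T_Suc\<close> multiplied by a power of x,
    one factor x of which stands in front of \<open>f j\<close>.\<close>
  have R_Suc: "((\<lambda>j. ?x * f j * SR N j) has_sum R (Suc N)) \<J>" for N
  proof (induction N)
    case 0
    have "R (Suc 0) = (\<Sum>\<^sub>\<infinity>j\<in>\<J>. ?x * f j * subst_r (step_q j) (step_r j) F)"
      using functional_equation by (simp add: R_def expansion_term_0[OF expansion_meaningful] algebra_simps)
    then show ?case
      using equation_meaningful by (simp add: SR_def)
  next
    case (Suc N)
    have "((\<lambda>j. - (?x ^ Suc N * (f j * U N j))) has_sum - (?x ^ Suc N * ?T (Suc N))) \<J>"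
      by (simp only: has_sum_uminus minus_minus has_sum_cmult_right[OF T_Suc])
    from has_sum_add[OF Suc this] show ?case
      by (simp add: R_def SR_def algebra_simps)
  qed
  have R_0: "mfps_nth (R N) \<mu> = 0" if "\<mu> X_var < N" for N \<mu>
    using that
  proof (induction N arbitrary: \<mu>)
    case (Suc N)
    show ?case
    proof (rule mfps_nth_has_sum_eq_0[OF R_Suc])
      fix j assume j: "j \<in> \<J>"
      show "mfps_nth (?x * f j * SR N j) \<mu> = 0"
      proof (cases "f j = 0")
        case False
        \<comment> \<open>Substitution keeps the exponent of x, so only coefficients of
          \<open>R N\<close> of the same degree in x enter.\<close>
        have SR_0: "mfps_nth (SR N j) \<beta> = 0" if "\<beta> X_var < N" for \<beta>
          using that Suc.IH
          by (intro mfps_nth_has_sum_eq_0[OF subst_R[OF j False, unfolded has_subst_def]]) auto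
        have "mfps_nth (?x * f j) \<alpha> * mfps_nth (SR N j) \<beta> = 0" if "\<alpha> + \<beta> = \<mu>" for \<alpha> \<beta>
        \<comment> \<open>The factor \<open>?x * f j\<close> has no terms of degree 0 in x. In the
          other case \<beta> has smaller degree than \<mu>, so \<open>SR_0\<close> applies.\<close>
        proof (cases "\<alpha> X_var = 0")
          case True
          then show ?thesis
            using mfps_nth_X_power_mult_eq_0[of \<alpha> 1 "f j"] by simp
        next
          case False
          then have "\<beta> X_var < N" using that Suc.prems by auto
          then show ?thesis by (simp add: SR_0)
        qed
        then show ?thesis
          unfolding mfps_nth_mult[of "?x * f j"] by (intro sum.neutral) auto
      qed simp
    qed
  qed simp
  have "(\<lambda>N. \<Sum>n<N. ?x ^ n * ?T n) \<longlonglongrightarrow> F"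
    unfolding tendsto_mfps_iff
  proof
    fix \<mu> :: "'m indet \<Rightarrow> nat"
    show "\<forall>\<^sub>F N in sequentially. mfps_nth (\<Sum>n<N. ?x ^ n * ?T n) \<mu> = mfps_nth F \<mu>"
      using eventually_gt_at_top[of "\<mu> X_var"]
    proof eventually_elim
      case (elim N)
      then have "mfps_nth (R N) \<mu> = 0" by (rule R_0)
      then show ?case by (simp add: R_def)
    qed
  qed
  then show "(\<lambda>n. ?x ^ n * (\<Sum>\<^sub>\<infinity>J\<in>sequences \<J> n. seq_term e f J)) sums F"
    by (simp add: sums_def expansion_term_def)
qed

end
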